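(* Let $d\ge2$, let $u=2k\ge4$ be even, and let $s\in(0,1]$. Let $P\subset\mathbb{F}_q^d$ satisfy \[ \sum_{m\in\mathbb{F}_q^d\setminus\{0\}}|\widehat P(m)|^u\le C_0\, q^{-(u-1)d}|P|^{u(1-s)}, \] with $C_0$ depending only on $u$. Let $S$ be a finite set of spheres $\{x:\|x-a\|=r\}$, $a\in\mathbb{F}_q^d$, $r\in\mathbb{F}_q$. Assume $|P|\ll q^{\frac{d}{us}}$. Then \[ \left|I(P,S)-\frac{|P|\,|S|}{q}\right|\ll_u q^{\frac du}|P|^{1-s}|S|^{1-\frac1u}. \]
   Context: $\chi$ is a fixed nontrivial additive character of $\mathbb{F}_q$ and $\widehat P(m):=q^{-d}\sum_{x\in P}\chi(-m\cdot x)$. $\|x\|:=x_1^2+\cdots+x_d^2$. $I(P,S):=|\{(x,\sigma)\in P\times S:x\in\sigma\}|$. $X\ll_u Y$ means $X\le CY$ with $C$ depending only on $u$ (and the implied constant in the hypothesis on $|P|$), not on $q$, $P$, $S$. *)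

theory Defs
  imports Complex_Main "HOL-Library.FuncSet" "HOL-Algebra.Ring"
begin

text \<open>
  The finite field is a record \<open>F\<close> rather than a type of class \<open>field\<close>, so that a constant
  uniform in the field can be quantified before it; the carrier type \<open>'a\<close> stays arbitrary, and for
  \<open>'a = nat\<close> the records cover all finite fields up to isomorphism. \<open>F\<^sup>d\<close> consists of the
  extensional functions on \<open>{..<d}\<close> with values in the carrier.
\<close>

definition fvecs :: "'a ring \<Rightarrow> nat \<Rightarrow> (nat \<Rightarrow> 'a) set" where
  "fvecs F d = {..<d} \<rightarrow>\<^sub>E carrier F"

definition fvec_zero :: "'a ring \<Rightarrow> nat \<Rightarrow> nat \<Rightarrow> 'a" where
  "fvec_zero F d = (\<lambda>i\<in>{..<d}. \<zero>\<^bsub>F\<^esub>)"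

definition fvec_diff :: "'a ring \<Rightarrow> nat \<Rightarrow> (nat \<Rightarrow> 'a) \<Rightarrow> (nat \<Rightarrow> 'a) \<Rightarrow> nat \<Rightarrow> 'a" where
  "fvec_diff F d x a = (\<lambda>i\<in>{..<d}. x i \<ominus>\<^bsub>F\<^esub> a i)"

definition fdot :: "'a ring \<Rightarrow> nat \<Rightarrow> (nat \<Rightarrow> 'a) \<Rightarrow> (nat \<Rightarrow> 'a) \<Rightarrow> 'a" where
  "fdot F d m x = (\<Oplus>\<^bsub>F\<^esub>i\<in>{..<d}. m i \<otimes>\<^bsub>F\<^esub> x i)"

definition fnorm :: "'a ring \<Rightarrow> nat \<Rightarrow> (nat \<Rightarrow> 'a) \<Rightarrow> 'a" where
  "fnorm F d x = (\<Oplus>\<^bsub>F\<^esub>i\<in>{..<d}. x i [^]\<^bsub>F\<^esub> (2::nat))"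

definition fsphere :: "'a ring \<Rightarrow> nat \<Rightarrow> (nat \<Rightarrow> 'a) \<Rightarrow> 'a \<Rightarrow> (nat \<Rightarrow> 'a) set" where
  "fsphere F d a r = {x \<in> fvecs F d. fnorm F d (fvec_diff F d x a) = r}"

text \<open>Spheres are point sets: parameters \<open>(a, r)\<close> giving the same point set give one sphere.\<close>

definition fspheres :: "'a ring \<Rightarrow> nat \<Rightarrow> (nat \<Rightarrow> 'a) set set" where
  "fspheres F d = {fsphere F d a r | a r. a \<in> fvecs F d \<and> r \<in> carrier F}"

definition nontrivial_additive_character :: "'a ring \<Rightarrow> ('a \<Rightarrow> complex) \<Rightarrow> bool" where
  "nontrivial_additive_character F \<chi> \<longleftrightarrow>
     (\<forall>x\<in>carrier F. cmod (\<chi> x) = 1) \<and>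
     (\<forall>x\<in>carrier F. \<forall>y\<in>carrier F. \<chi> (x \<oplus>\<^bsub>F\<^esub> y) = \<chi> x * \<chi> y) \<and>
     (\<exists>x\<in>carrier F. \<chi> x \<noteq> 1)"

definition fourier_coeff ::
  "'a ring \<Rightarrow> nat \<Rightarrow> ('a \<Rightarrow> complex) \<Rightarrow> (nat \<Rightarrow> 'a) set \<Rightarrow> (nat \<Rightarrow> 'a) \<Rightarrow> complex" where
  "fourier_coeff F d \<chi> P m =
     (\<Sum>x\<in>P. \<chi> (\<ominus>\<^bsub>F\<^esub> fdot F d m x)) / of_nat (card (carrier F) ^ d)"

definition incidences :: "'p set \<Rightarrow> 'p set set \<Rightarrow> nat" where
  "incidences P S = card {(x, \<sigma>). (x, \<sigma>) \<in> P \<times> S \<and> x \<in> \<sigma>}"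

end

(*
  Let f(a,r) = |P cap sigma| - |P|/q for the sphere sigma with centre a and radius r. By Hoelder's
  inequality over S it is enough to bound the sum of |f(a,r)|^u over all (a,r). For fixed a, the
  sum of f(a,r) chi(t r) over r is g(a,t) = sum_{x in P} chi(t ||x-a||) for t <> 0 and vanishes
  for t = 0, so Hausdorff-Young in r gives sum_r |f|^u <= q^(-1) sum_{t <> 0} |g(a,t)|^u.
  For fixed t <> 0 in odd characteristic, g(a,t) is up to a phase the sum over x of
  chi(t ||x||) chi(-2t a.x); since u is even, the factors chi(t ||x||) can only decrease the
  u-th moment over a, which leaves the u-th moment of the Fourier transform of P. Its m = 0 term
  |P|^u is absorbed by means of the bound on |P|.
*)
theory Submission
  imports Defs "HOL-Algebra.Product_Groups" "HOL-Algebra.Multiplicative_Group"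
begin

section \<open>Power means\<close>

text \<open>Convexity of the power function: multiplying the tangent bound for one exponent by
  \<open>x\<close> gives the next one, up to a nonnegative multiple of
  \<open>(x - y)^2\<close>.\<close>

lemma power_above_tangent:
  fixes x y :: real
  assumes "0 \<le> x" "0 \<le> y"
  shows "y ^ Suc n + real (Suc n) * y ^ n * (x - y) \<le> x ^ Suc n"
proof (induction n)
  case (Suc n)
  have "0 \<le> real (Suc n) * y ^ n * (x - y)\<^sup>2"
    using assms by simp
  then have "y ^ Suc (Suc n) + real (Suc (Suc n)) * y ^ Suc n * (x - y)
      \<le> x * (y ^ Suc n + real (Suc n) * y ^ n * (x - y))"
    by (simp add: algebra_simps power2_eq_square)
  also have "\<dots> \<le> x * x ^ Suc n"
    by (rule mult_left_mono[OF Suc \<open>0 \<le> x\<close>])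
  finally show ?case by simp
qed simp

text \<open>Jensen's inequality: at the mean \<open>y\<close> the linear terms of the tangent bounds
  sum to zero. This is the form in which Hoelder's inequality is applied to the spheres.\<close>

lemma sum_power_le_card:
  fixes f :: "'b \<Rightarrow> real"
  assumes "\<And>i. i \<in> A \<Longrightarrow> 0 \<le> f i"
  shows "(\<Sum>i\<in>A. f i) ^ Suc n \<le> real (card A) ^ n * (\<Sum>i\<in>A. f i ^ Suc n)"
proof (cases "card A = 0")
  case True
  then show ?thesis by (auto simp: card_eq_0_iff)
next
  case False
  define N y where "N = real (card A)" and "y = (\<Sum>i\<in>A. f i) / N"
  have N: "N > 0" and S: "(\<Sum>i\<in>A. f i) = N * y"
    using False by (auto simp: N_def y_def)
  have y: "y \<ge> 0"
    using assms N by (auto simp: y_def intro!: divide_nonneg_pos sum_nonneg)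
  have "N * y ^ Suc n = (\<Sum>i\<in>A. y ^ Suc n + real (Suc n) * y ^ n * (f i - y))"
    by (simp only: sum.distrib sum_distrib_left[symmetric] sum_subtractf S)
       (simp add: N_def)
  also have "\<dots> \<le> (\<Sum>i\<in>A. f i ^ Suc n)"
    by (intro sum_mono power_above_tangent assms y)
  finally have "N ^ n * (N * y ^ Suc n) \<le> N ^ n * (\<Sum>i\<in>A. f i ^ Suc n)"
    using N by (intro mult_left_mono) auto
  then show ?thesis
    by (simp add: S power_mult_distrib mult_ac flip: N_def)
qed

text \<open>The divisor \<open>N\<close> may exceed \<open>card A\<close>, because the
  \<open>q - 1\<close> nonzero frequencies are later averaged with weight
  \<open>1 / q\<close>.\<close>

lemma power_average_le:
  fixes f :: "'b \<Rightarrow> real"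
  assumes "\<And>i. i \<in> A \<Longrightarrow> 0 \<le> f i" and "0 < N" and "real (card A) \<le> N" and "0 < n"
  shows "((\<Sum>i\<in>A. f i) / N) ^ n \<le> (\<Sum>i\<in>A. f i ^ n) / N"
proof -
  obtain m where n: "n = Suc m"
    using \<open>0 < n\<close> gr0_implies_Suc by blast
  have "(\<Sum>i\<in>A. f i) ^ n \<le> real (card A) ^ m * (\<Sum>i\<in>A. f i ^ n)"
    unfolding n by (rule sum_power_le_card[OF assms(1)])
  also have "\<dots> \<le> N ^ m * (\<Sum>i\<in>A. f i ^ n)"
    using assms by (intro mult_right_mono power_mono sum_nonneg) auto
  finally show ?thesis
    using \<open>0 < N\<close> by (simp add: n power_divide field_simps)
qed

text \<open>Both factors are controlled by the mean of the highest powers. The product arises when a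
  sup norm bound is combined with Parseval's identity.\<close>

lemma average_power_prod_le:
  fixes f :: "'b \<Rightarrow> real"
  assumes "\<And>i. i \<in> A \<Longrightarrow> 0 \<le> f i" and "0 < N" and "real (card A) \<le> N" and "0 < k"
  shows "((\<Sum>i\<in>A. f i) / N) ^ (2 * k - 2) * ((\<Sum>i\<in>A. (f i)\<^sup>2) / N) \<le> (\<Sum>i\<in>A. f i ^ (2 * k)) / N"
    (is "?a ^ (2 * k - 2) * ?b \<le> ?c")
proof -
  have a: "?a ^ (2 * k) \<le> ?c"
    using assms by (intro power_average_le) auto
  have b: "?b ^ k \<le> ?c"
    using power_average_le[of A "\<lambda>i. (f i)\<^sup>2" N k] assms by (simp add: power_mult)
  have nonneg: "0 \<le> ?a" "0 \<le> ?b" "0 \<le> ?c"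
    using assms by (auto intro!: divide_nonneg_pos sum_nonneg)
  \<comment> \<open>Taking k-th powers avoids fractional exponents, since
    \<open>(2k - 2) k = 2k (k - 1)\<close>.\<close>
  have "(?a ^ (2 * k - 2) * ?b) ^ k = (?a ^ (2 * k)) ^ (k - 1) * ?b ^ k"
    by (simp only: power_mult_distrib power_mult[symmetric])
       (simp add: right_diff_distrib' left_diff_distrib' mult_ac)
  also have "\<dots> \<le> ?c ^ (k - 1) * ?c"
    using a b nonneg by (intro mult_mono power_mono) auto
  also have "\<dots> = ?c ^ k"
    using \<open>0 < k\<close> by (simp add: power_eq_if[of _ k])
  finally show ?thesis
    using nonneg \<open>0 < k\<close> by (metis power_mono_iff mult_nonneg_nonneg zero_le_power)
qed


section \<open>Characters and the majorant property of even exponents\<close>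

text \<open>The multiplicative form serves both \<open>add_monoid F\<close> and the group of
  vectors. Only values on the carrier are constrained.\<close>

definition characters :: "('a, 'b) monoid_scheme \<Rightarrow> ('a \<Rightarrow> complex) set" where
  "characters G = {\<psi>. (\<forall>x\<in>carrier G. cmod (\<psi> x) = 1) \<and>
     (\<forall>x\<in>carrier G. \<forall>y\<in>carrier G. \<psi> (x \<otimes>\<^bsub>G\<^esub> y) = \<psi> x * \<psi> y)}"

lemma characters_one: "(\<lambda>x. 1) \<in> characters G"
  by (simp add: characters_def)

lemma characters_mult:
  "\<psi> \<in> characters G \<Longrightarrow> \<phi> \<in> characters G \<Longrightarrow> (\<lambda>x. \<psi> x * \<phi> x) \<in> characters G"
  by (simp add: characters_def norm_mult mult_ac)

lemma characters_cnj: "\<psi> \<in> characters G \<Longrightarrow> (\<lambda>x. cnj (\<psi> x)) \<in> characters G"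
  by (simp add: characters_def)

lemma (in group) character_one:
  assumes "\<psi> \<in> characters G"
  shows "\<psi> \<one> = 1"
proof -
  have "\<psi> (\<one> \<otimes> \<one>) = \<psi> \<one> * \<psi> \<one>" "cmod (\<psi> \<one>) = 1"
    using assms one_closed by (simp_all only: characters_def mem_Collect_eq)
  then show ?thesis by auto
qed

lemma (in group) character_inv:
  assumes "\<psi> \<in> characters G" "x \<in> carrier G"
  shows "\<psi> (inv x) = cnj (\<psi> x)"
proof -
  have "\<psi> (inv x) * \<psi> x = 1"
  proof -
    have "\<psi> (inv x \<otimes> x) = \<psi> (inv x) * \<psi> x"
      using assms inv_closed by (simp only: characters_def mem_Collect_eq)
    then show ?thesis
      using assms character_one[OF assms(1)] by simp
  qed
  moreover have "\<psi> x * cnj (\<psi> x) = 1"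
    using assms by (simp add: characters_def flip: complex_norm_square)
  ultimately show ?thesis
    by (metis mult.assoc mult.left_neutral mult.right_neutral)
qed

text \<open>Translating the summation variable by \<open>y\<close> multiplies the sum by
  \<open>\<psi> y\<close>, which differs from 1.\<close>

lemma (in group) sum_character:
  assumes \<psi>: "\<psi> \<in> characters G" and y: "y \<in> carrier G" "\<psi> y \<noteq> 1"
  shows "(\<Sum>x\<in>carrier G. \<psi> x) = 0"
proof -
  have "bij_betw (\<lambda>x. y \<otimes> x) (carrier G) (carrier G)"
    by (rule bij_betw_byWitness[where f' = "\<lambda>x. inv y \<otimes> x"])
       (use y in \<open>auto simp: m_assoc[symmetric]\<close>)
  then have "(\<Sum>x\<in>carrier G. \<psi> x) = (\<Sum>x\<in>carrier G. \<psi> (y \<otimes> x))"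
    by (rule sum.reindex_bij_betw[symmetric])
  also have "\<dots> = \<psi> y * (\<Sum>x\<in>carrier G. \<psi> x)"
    using \<psi> y by (simp add: characters_def sum_distrib_left)
  finally show ?thesis
    using y(2) by (simp add: algebra_simps)
qed

text \<open>
  Coefficientwise domination of trigonometric polynomials: it survives products and conjugation,
  and summation over the group only sees the coefficients of the trivial character.
\<close>

inductive majorized :: "('a, 'b) monoid_scheme \<Rightarrow> ('a \<Rightarrow> complex) \<Rightarrow> ('a \<Rightarrow> complex) \<Rightarrow> bool"
  for G where
  zero: "majorized G (\<lambda>x. 0) (\<lambda>x. 0)"
| char: "\<psi> \<in> characters G \<Longrightarrow> cmod w \<le> c \<Longrightarrow> majorized G (\<lambda>x. w * \<psi> x) (\<lambda>x. of_real c * \<psi> x)"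
| add: "majorized G f g \<Longrightarrow> majorized G f' g' \<Longrightarrow>
    majorized G (\<lambda>x. f x + f' x) (\<lambda>x. g x + g' x)"

lemma majorized_char_mult:
  assumes "\<psi> \<in> characters G" "cmod w \<le> c" "majorized G f g"
  shows "majorized G (\<lambda>x. w * \<psi> x * f x) (\<lambda>x. of_real c * \<psi> x * g x)"
  using assms(3)
proof induction
  case zero
  show ?case using majorized.zero by simp
next
  case (char \<phi> v b)
  have "cmod (w * v) \<le> c * b"
    unfolding norm_mult using assms(2) char(2) norm_ge_zero[of w] norm_ge_zero[of v]
    by (intro mult_mono) linarith+
  from majorized.char[OF characters_mult[OF assms(1) char(1)] this] show ?case
    by (simp add: mult_ac)
next
  case (add f g f' g')
  from majorized.add[OF add.IH] show ?case
    by (simp add: distrib_left)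
qed

lemma majorized_mult:
  assumes "majorized G f g" "majorized G f' g'"
  shows "majorized G (\<lambda>x. f x * f' x) (\<lambda>x. g x * g' x)"
  using assms(1)
proof induction
  case zero
  show ?case using majorized.zero by simp
next
  case (char \<psi> w c)
  then show ?case by (intro majorized_char_mult assms(2))
next
  case (add f g f' g')
  from majorized.add[OF add.IH] show ?case
    by (simp add: distrib_right)
qed

lemma majorized_cnj:
  "majorized G f g \<Longrightarrow> majorized G (\<lambda>x. cnj (f x)) (\<lambda>x. cnj (g x))"
proof (induction rule: majorized.induct)
  case (char \<psi> w c)
  then show ?case
    using majorized.char[OF characters_cnj[OF char(1)], of "cnj w" c] by simp
qed (auto intro: majorized.zero majorized.add)

lemma majorized_power:
  assumes "majorized G f g"
  shows "majorized G (\<lambda>x. f x ^ k) (\<lambda>x. g x ^ k)"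
proof (induction k)
  case 0
  show ?case
    using majorized.char[OF characters_one, of 1 1] by simp
next
  case (Suc k)
  from majorized_mult[OF assms Suc] show ?case by simp
qed

text \<open>This is what removes phases: coefficients of modulus at most 1 are replaced by
  1.\<close>

lemma majorized_sum:
  assumes "finite A" "\<And>y. y \<in> A \<Longrightarrow> e y \<in> characters G" "\<And>y. y \<in> A \<Longrightarrow> cmod (w y) \<le> 1"
  shows "majorized G (\<lambda>x. \<Sum>y\<in>A. w y * e y x) (\<lambda>x. \<Sum>y\<in>A. e y x)"
  using assms
proof (induction A rule: finite_induct)
  case empty
  show ?case using majorized.zero by simp
next
  case (insert y A)
  have "majorized G (\<lambda>x. w y * e y x) (\<lambda>x. e y x)"
    using majorized.char[of "e y" G "w y" 1] insert.prems by simp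
  from majorized.add[OF this insert.IH] show ?case
    using insert by simp
qed

text \<open>By orthogonality a character contributes only if it is 1 on the whole carrier, and there
  \<open>cmod w \<le> c\<close> gives the bound.\<close>

lemma (in group) majorized_norm_sum_le:
  "majorized G f g \<Longrightarrow> cmod (\<Sum>x\<in>carrier G. f x) \<le> Re (\<Sum>x\<in>carrier G. g x)"
proof (induction rule: majorized.induct)
  case zero
  show ?case by simp
next
  case (char \<psi> w c)
  show ?case
  proof (cases "\<forall>x\<in>carrier G. \<psi> x = 1")
    case True
    then show ?thesis
      using char by (simp add: norm_mult mult_left_mono)
  next
    case False
    then have "(\<Sum>x\<in>carrier G. \<psi> x) = 0"
      using sum_character char by blast
    then show ?thesis
      by (simp flip: sum_distrib_left)
  qed
next
  case (add f g f' g')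
  have "cmod (\<Sum>x\<in>carrier G. f x + f' x)
      \<le> cmod (\<Sum>x\<in>carrier G. f x) + cmod (\<Sum>x\<in>carrier G. f' x)"
    by (simp add: sum.distrib norm_triangle_ineq)
  with add.IH show ?case by (simp add: sum.distrib)
qed

text \<open>An even power of the modulus is \<open>f^k\<close> times the conjugate of
  \<open>f^k\<close>, hence again a trigonometric polynomial to which domination extends.\<close>

lemma (in group) majorized_even_moment_le:
  assumes "majorized G f g"
  shows "(\<Sum>x\<in>carrier G. cmod (f x) ^ (2 * k)) \<le> (\<Sum>x\<in>carrier G. cmod (g x) ^ (2 * k))"
proof -
  have sq: "z ^ k * cnj z ^ k = of_real (cmod z ^ (2 * k))" for z
    by (simp add: power_mult flip: power_mult_distrib complex_norm_square)
  have "majorized G (\<lambda>x. f x ^ k * cnj (f x) ^ k) (\<lambda>x. g x ^ k * cnj (g x) ^ k)"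
    by (intro majorized_mult majorized_power majorized_cnj assms)
  from majorized_norm_sum_le[OF this] show ?thesis
    unfolding sq of_real_sum[symmetric] by (simp only: norm_of_real Re_complex_of_real)
qed


section \<open>Level sets of functions into a finite field\<close>

locale finite_field_character = field F for F :: "'a ring" (structure) +
  fixes \<chi> :: "'a \<Rightarrow> complex"
  assumes fin: "finite (carrier F)"
    and nontrivial: "nontrivial_additive_character F \<chi>"
begin

abbreviation q :: real where "q \<equiv> real (card (carrier F))"

lemma q_pos: "q > 0"
  using fin zero_closed by (auto simp: card_gt_0_iff)

lemma
  assumes "x \<in> carrier F"
  shows norm_chi: "cmod (\<chi> x) = 1"
    and chi_minus: "\<chi> (\<ominus> x) = cnj (\<chi> x)"
    and chi_add: "y \<in> carrier F \<Longrightarrow> \<chi> (x \<oplus> y) = \<chi> x * \<chi> y"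
proof -
  have "\<chi> \<in> characters (add_monoid F)"
    using nontrivial by (simp add: characters_def nontrivial_additive_character_def)
  from group.character_inv[OF a_group this] assms show "\<chi> (\<ominus> x) = cnj (\<chi> x)"
    by (simp add: a_inv_def)
qed (use nontrivial assms in \<open>auto simp: nontrivial_additive_character_def\<close>)

lemma chi_zero: "\<chi> \<zero> = 1"
proof -
  have "\<chi> \<zero> * \<chi> \<zero> = \<chi> \<zero>" "\<chi> \<zero> \<noteq> 0"
    using chi_add[of \<zero> \<zero>] norm_chi[of \<zero>] by auto
  then show ?thesis by simp
qed

text \<open>The character sending \<open>t\<close> to \<open>\<chi> (t \<otimes> y)\<close> is
  nontrivial: a point \<open>z\<close> with \<open>\<chi> z \<noteq> 1\<close> is reached at
  \<open>t = z \<otimes> inv y\<close>.\<close>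

lemma sum_chi_mult:
  assumes "y \<in> carrier F" "y \<noteq> \<zero>"
  shows "(\<Sum>t\<in>carrier F. \<chi> (t \<otimes> y)) = 0"
proof -
  obtain z where z: "z \<in> carrier F" "\<chi> z \<noteq> 1"
    using nontrivial by (auto simp: nontrivial_additive_character_def)
  have "y \<in> Units F"
    using assms field_Units by auto
  then have "z \<otimes> inv y \<in> carrier F" "(z \<otimes> inv y) \<otimes> y = z"
    using z assms by (auto simp: m_assoc)
  moreover have "(\<lambda>t. \<chi> (t \<otimes> y)) \<in> characters (add_monoid F)"
    using assms by (auto simp: characters_def norm_chi chi_add l_distr)
  ultimately show ?thesis
    using group.sum_character[OF a_group, of "\<lambda>t. \<chi> (t \<otimes> y)" "z \<otimes> inv y"] z by simp
qed

definition deviation :: "'p set \<Rightarrow> ('p \<Rightarrow> 'a) \<Rightarrow> 'a \<Rightarrow> real" where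
  "deviation P h r = real (card {x \<in> P. h x = r}) - real (card P) / q"

text \<open>The Fourier transform, at frequency \<open>t\<close>, of the level set counts of
  \<open>h\<close>. Keeping \<open>h\<close> arbitrary covers the norm seen from a centre as well as
  the plain norm.\<close>

definition exp_sum :: "'p set \<Rightarrow> ('p \<Rightarrow> 'a) \<Rightarrow> 'a \<Rightarrow> complex" where
  "exp_sum P h t = (\<Sum>x\<in>P. \<chi> (t \<otimes> h x))"

context
  fixes P :: "'p set" and h :: "'p \<Rightarrow> 'a"
  assumes finP: "finite P" and h: "h \<in> P \<rightarrow> carrier F"
begin

text \<open>Fourier inversion. The frequency 0 contributes \<open>card P\<close>, exactly the mean
  subtracted in \<open>deviation\<close>, and so is absent.\<close>

lemma deviation_eq:
  assumes r: "r \<in> carrier F"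
  shows "of_real (q * deviation P h r) = (\<Sum>t\<in>carrier F - {\<zero>}. \<chi> (\<ominus> (t \<otimes> r)) * exp_sum P h t)"
proof -
  have "(\<Sum>t\<in>carrier F. \<chi> (\<ominus> (t \<otimes> r)) * exp_sum P h t)
      = (\<Sum>x\<in>P. \<Sum>t\<in>carrier F. \<chi> (t \<otimes> (h x \<ominus> r)))"
    unfolding exp_sum_def sum_distrib_left
  proof (subst sum.swap, intro sum.cong refl)
    fix x t assume "x \<in> P" and t: "t \<in> carrier F"
    then have "h x \<in> carrier F" using h by auto
    then show "\<chi> (\<ominus> (t \<otimes> r)) * \<chi> (t \<otimes> h x) = \<chi> (t \<otimes> (h x \<ominus> r))"
      using t r by (simp add: a_minus_def r_distr r_minus chi_add)
  qed
  \<comment> \<open>Summing over all frequencies detects the condition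
    \<open>h x = r\<close>.\<close>
  also have "\<dots> = (\<Sum>x\<in>P. if h x = r then of_real q else 0)"
  proof (intro sum.cong refl)
    fix x assume "x \<in> P"
    then have "h x \<in> carrier F" using h by auto
    then show "(\<Sum>t\<in>carrier F. \<chi> (t \<otimes> (h x \<ominus> r))) = (if h x = r then of_real q else 0)"
      using r sum_chi_mult[of "h x \<ominus> r"] r_right_minus_eq[of "h x" r]
      by (cases "h x = r") (simp_all add: chi_zero del: r_right_minus_eq)
  qed
  also have "\<dots> = of_real (q * real (card {x \<in> P. h x = r}))"
    using finP by (simp add: sum.If_cases Int_def)
  also have "(\<Sum>t\<in>carrier F. \<chi> (\<ominus> (t \<otimes> r)) * exp_sum P h t)
      = of_nat (card P) + (\<Sum>t\<in>carrier F - {\<zero>}. \<chi> (\<ominus> (t \<otimes> r)) * exp_sum P h t)"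
    using h r by (subst sum.remove[OF fin zero_closed]) (simp add: exp_sum_def chi_zero Pi_iff)
  finally show ?thesis
    using q_pos by (simp add: deviation_def algebra_simps)
qed

text \<open>The constant \<open>card P / q\<close> is orthogonal to every nonzero frequency, and the
  counts regroup into a sum over \<open>P\<close>.\<close>

lemma sum_deviation_chi:
  assumes t: "t \<in> carrier F - {\<zero>}"
  shows "(\<Sum>r\<in>carrier F. of_real (deviation P h r) * \<chi> (\<ominus> (t \<otimes> r))) = cnj (exp_sum P h t)"
proof -
  have "(\<Sum>r\<in>carrier F. of_real (deviation P h r) * \<chi> (\<ominus> (t \<otimes> r)))
      = (\<Sum>r\<in>carrier F. of_nat (card {x \<in> P. h x = r}) * \<chi> (\<ominus> (t \<otimes> r)))
        - of_real (real (card P) / q) * (\<Sum>r\<in>carrier F. \<chi> (\<ominus> (t \<otimes> r)))"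
    by (simp add: deviation_def left_diff_distrib sum_subtractf sum_distrib_left)
  also have "(\<Sum>r\<in>carrier F. \<chi> (\<ominus> (t \<otimes> r))) = 0"
  proof -
    have "\<ominus> (t \<otimes> r) = r \<otimes> (\<ominus> t)" if "r \<in> carrier F" for r
      using t that by (simp add: m_comm r_minus)
    then show ?thesis
      using sum_chi_mult[of "\<ominus> t"] t add.inv_eq_1_iff[of t] by simp
  qed
  also have "(\<Sum>r\<in>carrier F. of_nat (card {x \<in> P. h x = r}) * \<chi> (\<ominus> (t \<otimes> r)))
      = (\<Sum>r\<in>carrier F. \<Sum>x\<in>{x \<in> P. h x = r}. \<chi> (\<ominus> (t \<otimes> h x)))"
    by simp
  also have "\<dots> = (\<Sum>x\<in>P. \<chi> (\<ominus> (t \<otimes> h x)))"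
    using h finP fin by (intro sum.group) auto
  also have "\<dots> = cnj (exp_sum P h t)"
    using h t by (simp add: exp_sum_def chi_minus Pi_iff)
  finally show ?thesis by simp
qed

text \<open>Parseval's identity: inversion is inserted for one of the two factors, and after the
  swap the inner sum is the forward transform.\<close>

lemma sum_deviation_square:
  "q * (\<Sum>r\<in>carrier F. (deviation P h r)\<^sup>2) = (\<Sum>t\<in>carrier F - {\<zero>}. (cmod (exp_sum P h t))\<^sup>2)"
proof -
  have "complex_of_real (q * (\<Sum>r\<in>carrier F. (deviation P h r)\<^sup>2))
      = (\<Sum>r\<in>carrier F. of_real (q * deviation P h r) * of_real (deviation P h r))"
    by (simp add: sum_distrib_left power2_eq_square mult_ac)
  also have "\<dots> = (\<Sum>r\<in>carrier F. \<Sum>t\<in>carrier F - {\<zero>}.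
      exp_sum P h t * (of_real (deviation P h r) * \<chi> (\<ominus> (t \<otimes> r))))"
    by (intro sum.cong refl) (simp only: deviation_eq sum_distrib_right, simp add: mult_ac)
  also have "\<dots> = (\<Sum>t\<in>carrier F - {\<zero>}. exp_sum P h t * cnj (exp_sum P h t))"
    by (subst sum.swap) (simp add: sum_deviation_chi flip: sum_distrib_left)
  also have "\<dots> = complex_of_real (\<Sum>t\<in>carrier F - {\<zero>}. (cmod (exp_sum P h t))\<^sup>2)"
    unfolding of_real_sum by (intro sum.cong refl) (metis complex_norm_square of_real_power)
  finally show ?thesis
    by (simp only: of_real_eq_iff)
qed

text \<open>
  A Hausdorff--Young inequality obtained from the sup norm and Parseval. A triangle inequality for
  each \<open>r\<close> separately would lose a factor of \<open>q\<close>.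
\<close>

lemma sum_deviation_power_le:
  assumes "0 < k"
  shows "(\<Sum>r\<in>carrier F. \<bar>deviation P h r\<bar> ^ (2 * k))
      \<le> (\<Sum>t\<in>carrier F - {\<zero>}. cmod (exp_sum P h t) ^ (2 * k)) / q"
proof -
  \<comment> \<open>The bound for the sup norm given by Fourier inversion and the triangle
    inequality.\<close>
  define B where "B = (\<Sum>t\<in>carrier F - {\<zero>}. cmod (exp_sum P h t)) / q"
  have sup: "\<bar>deviation P h r\<bar> \<le> B" if r: "r \<in> carrier F" for r
  proof -
    have "\<bar>q * deviation P h r\<bar> = cmod (\<Sum>t\<in>carrier F - {\<zero>}. \<chi> (\<ominus> (t \<otimes> r)) * exp_sum P h t)"
      by (simp only: norm_of_real flip: deviation_eq[OF r])
    also have "\<dots> \<le> (\<Sum>t\<in>carrier F - {\<zero>}. cmod (\<chi> (\<ominus> (t \<otimes> r)) * exp_sum P h t))"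
      by (rule norm_sum)
    also have "\<dots> = (\<Sum>t\<in>carrier F - {\<zero>}. cmod (exp_sum P h t))"
      using r by (intro sum.cong) (auto simp: norm_mult norm_chi)
    finally show ?thesis
      using q_pos by (simp add: B_def abs_mult field_simps)
  qed
  have "(\<Sum>r\<in>carrier F. \<bar>deviation P h r\<bar> ^ (2 * k))
      = (\<Sum>r\<in>carrier F. \<bar>deviation P h r\<bar> ^ (2 * k - 2) * (deviation P h r)\<^sup>2)"
  proof (intro sum.cong refl)
    fix r
    \<comment> \<open>Positivity of \<open>k\<close> makes the truncated subtraction exact.\<close>
    have "2 * k = (2 * k - 2) + 2" using assms by simp
    then show "\<bar>deviation P h r\<bar> ^ (2 * k) = \<bar>deviation P h r\<bar> ^ (2 * k - 2) * (deviation P h r)\<^sup>2"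
      by (metis power_add power2_abs)
  qed
  \<comment> \<open>Interpolation: the sup norm bounds \<open>2k - 2\<close> factors, and the
    remaining square is left to Parseval.\<close>
  also have "\<dots> \<le> (\<Sum>r\<in>carrier F. B ^ (2 * k - 2) * (deviation P h r)\<^sup>2)"
    by (intro sum_mono mult_right_mono power_mono sup) auto
  also have "\<dots> = B ^ (2 * k - 2) * ((\<Sum>t\<in>carrier F - {\<zero>}. (cmod (exp_sum P h t))\<^sup>2) / q)"
    using q_pos by (simp flip: sum_deviation_square sum_distrib_left)
  also have "\<dots> \<le> (\<Sum>t\<in>carrier F - {\<zero>}. cmod (exp_sum P h t) ^ (2 * k)) / q"
    unfolding B_def
  proof (rule average_power_prod_le)
    show "real (card (carrier F - {\<zero>})) \<le> q"
      using fin by (simp add: card_Diff1_le)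
  qed (use q_pos assms in auto)
  finally show ?thesis .
qed

end


section \<open>Moments over the family of spheres\<close>

lemma finite_fvecs: "finite (fvecs F d)"
  unfolding fvecs_def using fin by (intro finite_PiE) auto

lemma fvecs_apply: "x \<in> fvecs F d \<Longrightarrow> i < d \<Longrightarrow> x i \<in> carrier F"
  by (auto simp: fvecs_def)

lemma fvec_zero_in_fvecs: "fvec_zero F d \<in> fvecs F d"
  by (auto simp: fvecs_def fvec_zero_def)

text \<open>Pointwise addition on extensional functions, so that the results on characters and
  majorants apply to \<open>F^d\<close>.\<close>

abbreviation fvec_group :: "nat \<Rightarrow> (nat \<Rightarrow> 'a) monoid" where
  "fvec_group d \<equiv> product_group {..<d} (\<lambda>_. add_monoid F)"

lemma group_fvec_group: "group (fvec_group d)"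
  by (intro product_group a_group)

lemma carrier_fvec_group: "carrier (fvec_group d) = fvecs F d"
  by (simp add: fvecs_def)

lemma fdot_closed: "a \<in> fvecs F d \<Longrightarrow> x \<in> fvecs F d \<Longrightarrow> fdot F d a x \<in> carrier F"
  unfolding fdot_def by (intro finsum_closed) (auto simp: fvecs_apply)

lemma fnorm_closed: "x \<in> fvecs F d \<Longrightarrow> fnorm F d x \<in> carrier F"
  unfolding fnorm_def by (intro finsum_closed) (auto simp: fvecs_apply)

lemma fvec_diff_closed: "x \<in> fvecs F d \<Longrightarrow> a \<in> fvecs F d \<Longrightarrow> fvec_diff F d x a \<in> fvecs F d"
  by (auto simp: fvecs_def fvec_diff_def PiE_iff)

lemma fdot_zero_left: "x \<in> fvecs F d \<Longrightarrow> fdot F d (fvec_zero F d) x = \<zero>"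
  unfolding fdot_def fvec_zero_def
  by (subst finsum_cong'[of _ _ "\<lambda>_. \<zero>"]) (auto simp: fvecs_apply)

lemma fdot_add_left:
  assumes "a \<in> fvecs F d" "b \<in> fvecs F d" "x \<in> fvecs F d"
  shows "fdot F d (\<lambda>i\<in>{..<d}. a i \<oplus> b i) x = fdot F d a x \<oplus> fdot F d b x"
proof -
  have "fdot F d (\<lambda>i\<in>{..<d}. a i \<oplus> b i) x = (\<Oplus>i\<in>{..<d}. a i \<otimes> x i \<oplus> b i \<otimes> x i)"
    unfolding fdot_def by (intro finsum_cong') (use assms in \<open>auto simp: fvecs_apply l_distr\<close>)
  then show ?thesis
    using assms by (simp add: fdot_def finsum_addf fvecs_apply Pi_iff)
qed

lemma fdot_scale_left:
  assumes "c \<in> carrier F" "a \<in> fvecs F d" "x \<in> fvecs F d"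
  shows "fdot F d (\<lambda>i\<in>{..<d}. c \<otimes> a i) x = c \<otimes> fdot F d a x"
  unfolding fdot_def using assms
  by (subst finsum_rdistr)
     (auto simp: fvecs_apply m_assoc intro!: finsum_cong')

lemma chi_fdot_in_characters:
  assumes "t \<in> carrier F" "x \<in> fvecs F d"
  shows "(\<lambda>a. \<chi> (\<ominus> (t \<otimes> fdot F d a x))) \<in> characters (fvec_group d)"
  using assms unfolding characters_def carrier_fvec_group mult_product_group
  by (simp add: norm_chi fdot_closed fdot_add_left r_distr minus_add chi_add)

text \<open>Allows a nonzero factor in the frequency to be removed from sums over all
  vectors.\<close>

lemma bij_betw_scale:
  assumes "c \<in> carrier F" "c \<noteq> \<zero>"
  shows "bij_betw (\<lambda>a. \<lambda>i\<in>{..<d}. c \<otimes> a i) (fvecs F d) (fvecs F d)"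
proof (rule bij_betw_byWitness[where f' = "\<lambda>a. \<lambda>i\<in>{..<d}. inv c \<otimes> a i"])
  have "c \<in> Units F"
    using assms field_Units by auto
  then have inv: "inv c \<in> carrier F" "inv c \<otimes> c = \<one>" "c \<otimes> inv c = \<one>"
    by auto
  have scale: "(\<lambda>i\<in>{..<d}. b \<otimes> (\<lambda>i\<in>{..<d}. b' \<otimes> a i) i) = a"
    if "a \<in> fvecs F d" "b \<in> carrier F" "b' \<in> carrier F" "b \<otimes> b' = \<one>" for a b b'
  proof
    fix i
    show "(\<lambda>i\<in>{..<d}. b \<otimes> (\<lambda>i\<in>{..<d}. b' \<otimes> a i) i) i = a i"
    proof (cases "i < d")
      case True
      then show ?thesis
        using that(2-4) fvecs_apply[OF that(1) True] by (simp add: m_assoc[symmetric])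
    next
      \<comment> \<open>Outside the index range both functions take the value
        \<open>undefined\<close>.\<close>
      case False
      then show ?thesis
        using PiE_arb[OF that(1)[unfolded fvecs_def], of i] by simp
    qed
  qed
  show "\<forall>a\<in>fvecs F d. (\<lambda>i\<in>{..<d}. inv c \<otimes> (\<lambda>i\<in>{..<d}. c \<otimes> a i) i) = a"
    "\<forall>a\<in>fvecs F d. (\<lambda>i\<in>{..<d}. c \<otimes> (\<lambda>i\<in>{..<d}. inv c \<otimes> a i) i) = a"
    using scale[OF _ inv(1) assms(1) inv(2)] scale[OF _ assms(1) inv(1) inv(3)] by simp_all
  show "(\<lambda>a. \<lambda>i\<in>{..<d}. c \<otimes> a i) ` fvecs F d \<subseteq> fvecs F d"
    "(\<lambda>a. \<lambda>i\<in>{..<d}. inv c \<otimes> a i) ` fvecs F d \<subseteq> fvecs F d"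
    using inv(1) assms(1) by (simp_all add: fvecs_def image_subset_iff PiE_iff)
qed

text \<open>With 2 written as \<open>\<one> \<oplus> \<one>\<close> the identity serves the odd and
  the even characteristic alike.\<close>

lemma square_diff:
  assumes "x \<in> carrier F" "y \<in> carrier F"
  shows "(x \<ominus> y) [^] (2::nat) = x [^] (2::nat) \<oplus> y [^] (2::nat) \<oplus> \<ominus> (\<one> \<oplus> \<one>) \<otimes> (y \<otimes> x)"
  using assms unfolding numeral_2_eq_2 by (simp, algebra)

text \<open>The dot product is the only term coupling point and centre. Its coefficient vanishes
  precisely in characteristic two, whence the later case distinction.\<close>

lemma fnorm_diff:
  assumes "x \<in> fvecs F d" "a \<in> fvecs F d"
  shows "fnorm F d (fvec_diff F d x a)
    = fnorm F d x \<oplus> fnorm F d a \<oplus> \<ominus> (\<one> \<oplus> \<one>) \<otimes> fdot F d a x"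
proof -
  have "fnorm F d (fvec_diff F d x a)
      = (\<Oplus>i\<in>{..<d}. x i [^] (2::nat) \<oplus> a i [^] (2::nat) \<oplus> \<ominus> (\<one> \<oplus> \<one>) \<otimes> (a i \<otimes> x i))"
    unfolding fnorm_def
    by (intro finsum_cong') (use assms in \<open>auto simp: fvec_diff_def fvecs_apply square_diff\<close>)
  then show ?thesis
    using assms by (simp add: fnorm_def fdot_def finsum_addf finsum_rdistr fvecs_apply Pi_iff)
qed

section \<open>Moments of the Fourier transform of the point set\<close>

definition fourier_moment :: "nat \<Rightarrow> (nat \<Rightarrow> 'a) set \<Rightarrow> nat \<Rightarrow> real" where
  "fourier_moment d P n = (\<Sum>m\<in>fvecs F d. cmod (\<Sum>x\<in>P. \<chi> (\<ominus> fdot F d m x)) ^ n)"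

text \<open>The moment is unnormalised and includes the frequency 0; separating that term and
  restoring the factor \<open>q^d\<close> leads to the sum in the hypothesis on
  \<open>P\<close>.\<close>

lemma fourier_moment_eq:
  assumes "P \<subseteq> fvecs F d"
  shows "fourier_moment d P n = real (card P) ^ n
    + q ^ (d * n) * (\<Sum>m\<in>fvecs F d - {fvec_zero F d}. cmod (fourier_coeff F d \<chi> P m) ^ n)"
proof -
  have "(\<Sum>x\<in>P. \<chi> (\<ominus> fdot F d (fvec_zero F d) x)) = of_nat (card P)"
    using assms by (simp add: fdot_zero_left chi_zero subset_iff)
  moreover have "cmod (\<Sum>x\<in>P. \<chi> (\<ominus> fdot F d m x)) ^ n
      = q ^ (d * n) * cmod (fourier_coeff F d \<chi> P m) ^ n" for m
    using q_pos by (simp add: fourier_coeff_def norm_divide norm_power power_divide power_mult)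
  ultimately show ?thesis
    unfolding fourier_moment_def sum.remove[OF finite_fvecs fvec_zero_in_fvecs]
    by (simp add: sum_distrib_left)
qed

text \<open>
  Expanding \<open>\<parallel>x - a\<parallel>\<close> writes the exponential sum over \<open>x\<close> as a character sum in the centre \<open>a\<close>
  with unimodular coefficients \<open>\<chi> (t \<parallel>x\<parallel>)\<close>, which the majorant property removes.
\<close>

lemma sum_centres_le_fourier_moment:
  assumes char: "\<one> \<oplus> \<one> \<noteq> \<zero>" and P: "P \<subseteq> fvecs F d" and t: "t \<in> carrier F - {\<zero>}"
  shows "(\<Sum>a\<in>fvecs F d. cmod (\<Sum>x\<in>P. \<chi> (t \<otimes> fnorm F d (fvec_diff F d x a))) ^ (2 * k))
    \<le> fourier_moment d P (2 * k)"
proof -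
  \<comment> \<open>The frequency \<open>2t\<close> of the cross term, nonzero because the
    characteristic is odd.\<close>
  define c where "c = t \<otimes> (\<one> \<oplus> \<one>)"
  have c: "c \<in> carrier F" "c \<noteq> \<zero>"
    using t char integral[of t "\<one> \<oplus> \<one>"] by (auto simp: c_def)
  have "majorized (fvec_group d) (\<lambda>a. \<Sum>x\<in>P. \<chi> (t \<otimes> fnorm F d x) * \<chi> (\<ominus> (c \<otimes> fdot F d a x)))
      (\<lambda>a. \<Sum>x\<in>P. \<chi> (\<ominus> (c \<otimes> fdot F d a x)))"
  proof (rule majorized_sum)
    show "finite P"
      using P finite_fvecs finite_subset by blast
    show "(\<lambda>a. \<chi> (\<ominus> (c \<otimes> fdot F d a x))) \<in> characters (fvec_group d)" if "x \<in> P" for x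
      using P c that by (intro chi_fdot_in_characters) auto
  qed (use P t in \<open>auto simp: norm_chi fnorm_closed subset_iff\<close>)
  note group.majorized_even_moment_le[OF group_fvec_group this, of k]
  \<comment> \<open>The phase coming from the norm of \<open>a\<close> is the same for all
    \<open>x\<close> and drops out of the modulus.\<close>
  moreover have "cmod (\<Sum>x\<in>P. \<chi> (t \<otimes> fnorm F d (fvec_diff F d x a)))
      = cmod (\<Sum>x\<in>P. \<chi> (t \<otimes> fnorm F d x) * \<chi> (\<ominus> (c \<otimes> fdot F d a x)))"
    if a: "a \<in> fvecs F d" for a
  proof -
    have "(\<Sum>x\<in>P. \<chi> (t \<otimes> fnorm F d (fvec_diff F d x a)))
        = \<chi> (t \<otimes> fnorm F d a) * (\<Sum>x\<in>P. \<chi> (t \<otimes> fnorm F d x) * \<chi> (\<ominus> (c \<otimes> fdot F d a x)))"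
      unfolding sum_distrib_left
    proof (intro sum.cong refl)
      fix x assume "x \<in> P"
      then have x: "x \<in> fvecs F d" using P by auto
      have "t \<otimes> fnorm F d (fvec_diff F d x a)
          = t \<otimes> fnorm F d a \<oplus> (t \<otimes> fnorm F d x \<oplus> \<ominus> (c \<otimes> fdot F d a x))"
        using t fnorm_closed[OF x] fnorm_closed[OF a] fdot_closed[OF a x]
        unfolding fnorm_diff[OF x a] c_def by (simp, algebra)
      then show "\<chi> (t \<otimes> fnorm F d (fvec_diff F d x a))
          = \<chi> (t \<otimes> fnorm F d a) * (\<chi> (t \<otimes> fnorm F d x) * \<chi> (\<ominus> (c \<otimes> fdot F d a x)))"
        using t c fnorm_closed[OF x] fnorm_closed[OF a] fdot_closed[OF a x] by (simp add: chi_add)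
    qed
    then show ?thesis
      using t a by (simp add: norm_mult norm_chi fnorm_closed)
  qed
  \<comment> \<open>Scaling by \<open>c\<close> permutes the vectors, so the frequencies
    \<open>c a\<close> run through all \<open>m\<close> once.\<close>
  moreover have "(\<Sum>a\<in>fvecs F d. cmod (\<Sum>x\<in>P. \<chi> (\<ominus> (c \<otimes> fdot F d a x))) ^ (2 * k))
      = fourier_moment d P (2 * k)"
    unfolding fourier_moment_def
    by (subst sum.reindex_bij_betw[OF bij_betw_scale[OF c], symmetric])
       (use P c in \<open>auto simp: fdot_scale_left subset_iff intro!: sum.cong arg_cong[of _ _ "\<lambda>z. cmod z ^ (2 * k)"]\<close>)
  ultimately show ?thesis
    by (simp only: carrier_fvec_group cong: sum.cong)
qed

section \<open>Deviations summed over spheres\<close>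

definition sphere_deviation :: "(nat \<Rightarrow> 'a) set \<Rightarrow> (nat \<Rightarrow> 'a) set \<Rightarrow> real" where
  "sphere_deviation P \<sigma> = real (card (P \<inter> \<sigma>)) - real (card P) / q"

text \<open>Hausdorff-Young in the radius for each centre, followed by the majorant bound over the
  centres for each frequency.\<close>

lemma sum_sphere_deviation_odd:
  assumes char: "\<one> \<oplus> \<one> \<noteq> \<zero>" and P: "P \<subseteq> fvecs F d" and S: "S \<subseteq> fspheres F d" and k: "0 < k"
  shows "(\<Sum>\<sigma>\<in>S. \<bar>sphere_deviation P \<sigma>\<bar> ^ (2 * k)) \<le> fourier_moment d P (2 * k)"
proof -
  let ?A = "fvecs F d \<times> carrier F" and ?g = "\<lambda>(a, r). fsphere F d a r"
  let ?f = "\<lambda>\<sigma>. \<bar>sphere_deviation P \<sigma>\<bar> ^ (2 * k)"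
  let ?h = "\<lambda>a x. fnorm F d (fvec_diff F d x a)"
  have finP: "finite P"
    using P finite_fvecs finite_subset by blast
  have finA: "finite ?A"
    using finite_fvecs fin by simp
  have dev: "sphere_deviation P (fsphere F d a r) = deviation P (?h a) r" for a r
  proof -
    have "P \<inter> fsphere F d a r = {x \<in> P. ?h a x = r}"
      using P by (auto simp: fsphere_def)
    then show ?thesis
      by (simp add: sphere_deviation_def deviation_def)
  qed
  have "fspheres F d = ?g ` ?A"
    by (auto simp: fspheres_def image_iff)
  then have "sum ?f S \<le> sum ?f (?g ` ?A)"
    using S finA by (intro sum_mono2) auto
  \<comment> \<open>Several pairs may describe one sphere; repetitions only add nonnegative
    terms.\<close>
  also have "\<dots> \<le> sum (?f \<circ> ?g) ?A"
    using finA by (intro sum_image_le) auto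
  also have "\<dots> = (\<Sum>a\<in>fvecs F d. \<Sum>r\<in>carrier F. \<bar>deviation P (?h a) r\<bar> ^ (2 * k))"
    unfolding sum.cartesian_product by (intro sum.cong) (auto simp: dev)
  also have "\<dots> \<le> (\<Sum>a\<in>fvecs F d.
      (\<Sum>t\<in>carrier F - {\<zero>}. cmod (exp_sum P (?h a) t) ^ (2 * k)) / q)"
    using P by (intro sum_mono sum_deviation_power_le finP k)
      (auto intro!: fnorm_closed fvec_diff_closed)
  also have "\<dots> = (\<Sum>t\<in>carrier F - {\<zero>}.
      (\<Sum>a\<in>fvecs F d. cmod (\<Sum>x\<in>P. \<chi> (t \<otimes> ?h a x)) ^ (2 * k)) / q)"
    unfolding sum_divide_distrib exp_sum_def by (rule sum.swap)
  also have "\<dots> \<le> (\<Sum>t\<in>carrier F - {\<zero>}. fourier_moment d P (2 * k) / q)"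
    using q_pos by (intro sum_mono divide_right_mono sum_centres_le_fourier_moment char P) auto
  \<comment> \<open>There are at most \<open>q\<close> frequencies, so the factor
    \<open>1 / q\<close> from Hausdorff-Young cancels their number.\<close>
  also have "\<dots> \<le> q * (fourier_moment d P (2 * k) / q)"
    unfolding sum_constant using q_pos fin
    by (intro mult_right_mono divide_nonneg_pos) (auto simp: fourier_moment_def card_Diff1_le sum_nonneg)
  finally show ?thesis
    using q_pos by simp
qed

text \<open>
  In characteristic two \<open>\<parallel>x - a\<parallel> = \<parallel>x\<parallel> + \<parallel>a\<parallel>\<close>, so there are at most \<open>q\<close> spheres and the
  trivial bound for the exponential sums suffices.
\<close>

lemma sum_sphere_deviation_even:
  assumes char: "\<one> \<oplus> \<one> = \<zero>" and P: "P \<subseteq> fvecs F d" and S: "S \<subseteq> fspheres F d" and k: "0 < k"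
  shows "(\<Sum>\<sigma>\<in>S. \<bar>sphere_deviation P \<sigma>\<bar> ^ (2 * k)) \<le> fourier_moment d P (2 * k)"
proof -
  let ?g = "\<lambda>r. {x \<in> fvecs F d. fnorm F d x = r}"
  let ?f = "\<lambda>\<sigma>. \<bar>sphere_deviation P \<sigma>\<bar> ^ (2 * k)"
  have finP: "finite P"
    using P finite_fvecs finite_subset by blast
  have dev: "sphere_deviation P (?g r) = deviation P (fnorm F d) r" for r
  proof -
    have "P \<inter> ?g r = {x \<in> P. fnorm F d x = r}"
      using P by auto
    then show ?thesis
      by (simp add: sphere_deviation_def deviation_def)
  qed
  \<comment> \<open>The norm of the centre is absorbed into the radius, so every sphere is a level
    set of the norm.\<close>
  have "\<sigma> \<in> ?g ` carrier F" if "\<sigma> \<in> fspheres F d" for \<sigma>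
  proof -
    obtain a r where \<sigma>: "\<sigma> = fsphere F d a r" and a: "a \<in> fvecs F d" and r: "r \<in> carrier F"
      using \<open>\<sigma> \<in> fspheres F d\<close> by (auto simp: fspheres_def)
    have "fnorm F d (fvec_diff F d x a) = r \<longleftrightarrow> fnorm F d x = r \<ominus> fnorm F d a"
      if x: "x \<in> fvecs F d" for x
    proof -
      have "fnorm F d (fvec_diff F d x a) = fnorm F d x \<oplus> fnorm F d a"
        using fnorm_diff[OF x a] char fnorm_closed[OF x] fnorm_closed[OF a] fdot_closed[OF a x]
        by simp
      then show ?thesis
        using r fnorm_closed[OF x] fnorm_closed[OF a]
        by (auto simp: a_minus_def a_assoc r_neg l_neg)
    qed
    then have "\<sigma> = ?g (r \<ominus> fnorm F d a)"
      by (auto simp: \<sigma> fsphere_def)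
    then show ?thesis
      using r fnorm_closed[OF a] by blast
  qed
  then have "sum ?f S \<le> sum ?f (?g ` carrier F)"
    using S fin by (intro sum_mono2) auto
  also have "\<dots> \<le> sum (?f \<circ> ?g) (carrier F)"
    using fin by (intro sum_image_le) auto
  also have "\<dots> = (\<Sum>r\<in>carrier F. \<bar>deviation P (fnorm F d) r\<bar> ^ (2 * k))"
    by (simp add: dev)
  also have "\<dots> \<le> (\<Sum>t\<in>carrier F - {\<zero>}. cmod (exp_sum P (fnorm F d) t) ^ (2 * k)) / q"
    using P by (intro sum_deviation_power_le finP k) (auto intro!: fnorm_closed)
  also have "\<dots> \<le> (\<Sum>t\<in>carrier F - {\<zero>}. real (card P) ^ (2 * k)) / q"
  proof (intro divide_right_mono sum_mono power_mono)
    fix t assume "t \<in> carrier F - {\<zero>}"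
    then have "cmod (exp_sum P (fnorm F d) t) \<le> (\<Sum>x\<in>P. 1)"
      unfolding exp_sum_def using P
      by (intro sum_norm_le) (auto simp: norm_chi fnorm_closed subset_iff)
    then show "cmod (exp_sum P (fnorm F d) t) \<le> real (card P)"
      by simp
  qed (use q_pos in auto)
  also have "\<dots> \<le> q * real (card P) ^ (2 * k) / q"
    unfolding sum_constant using fin
    by (intro divide_right_mono mult_right_mono) (auto simp: card_Diff1_le)
  \<comment> \<open>The trivial bound is already the frequency 0 term of the moment.\<close>
  also have "\<dots> \<le> fourier_moment d P (2 * k)"
    using q_pos by (simp add: fourier_moment_eq[OF P] sum_nonneg)
  finally show ?thesis .
qed

section \<open>From sphere deviations to incidences\<close>

lemma incidences_eq:
  assumes "finite P" "finite S"
  shows "real (incidences P S) = (\<Sum>\<sigma>\<in>S. real (card (P \<inter> \<sigma>)))"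
proof -
  have "{(x, \<sigma>). (x, \<sigma>) \<in> P \<times> S \<and> x \<in> \<sigma>} = (\<lambda>(\<sigma>, x). (x, \<sigma>)) ` (SIGMA \<sigma>:S. P \<inter> \<sigma>)"
    by auto
  then have "incidences P S = card (SIGMA \<sigma>:S. P \<inter> \<sigma>)"
    by (simp add: incidences_def card_image inj_on_def split_beta prod_eq_iff)
  then show ?thesis
    using assms by (simp add: card_SigmaI)
qed

text \<open>The incidence error is the sum of the sphere deviations. Hoelder over \<open>S\<close>
  reduces it to their moment, which is bounded in either characteristic.\<close>

lemma incidence_deviation_power_le:
  assumes P: "P \<subseteq> fvecs F d" and S: "S \<subseteq> fspheres F d" "finite S" and k: "0 < k"
  shows "\<bar>real (incidences P S) - real (card P) * real (card S) / q\<bar> ^ (2 * k)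
    \<le> real (card S) ^ (2 * k - 1) * fourier_moment d P (2 * k)"
proof -
  obtain n where n: "2 * k = Suc n"
    using k by (metis gr0_implies_Suc nat_0_less_mult_iff zero_less_numeral)
  have "finite P"
    using P finite_fvecs finite_subset by blast
  then have "real (incidences P S) - real (card P) * real (card S) / q
      = (\<Sum>\<sigma>\<in>S. sphere_deviation P \<sigma>)"
    using S by (simp add: incidences_eq sphere_deviation_def sum_subtractf)
  then have "\<bar>real (incidences P S) - real (card P) * real (card S) / q\<bar> ^ (2 * k)
      \<le> (\<Sum>\<sigma>\<in>S. \<bar>sphere_deviation P \<sigma>\<bar>) ^ (2 * k)"
    by (simp add: sum_abs power_mono)
  also have "\<dots> \<le> real (card S) ^ (2 * k - 1) * (\<Sum>\<sigma>\<in>S. \<bar>sphere_deviation P \<sigma>\<bar> ^ (2 * k))"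
    unfolding n using sum_power_le_card[of S "\<lambda>\<sigma>. \<bar>sphere_deviation P \<sigma>\<bar>" n] by simp
  also have "\<dots> \<le> real (card S) ^ (2 * k - 1) * fourier_moment d P (2 * k)"
    using sum_sphere_deviation_odd[OF _ P S(1) k] sum_sphere_deviation_even[OF _ P S(1) k]
    by (intro mult_left_mono) auto
  finally show ?thesis .
qed

text \<open>At frequency 0, \<open>|P|^u\<close> splits into \<open>|P|^(us)\<close>, which the size
  bound compares with \<open>q^d\<close>, and \<open>|P|^(u(1-s))\<close>. At the other frequencies
  the powers of \<open>q\<close> combine to \<open>q^(du - (u-1)d) = q^d\<close>.\<close>

lemma fourier_moment_le:
  fixes u :: nat and C\<^sub>0 C\<^sub>1 s :: real
  assumes P: "P \<subseteq> fvecs F d" "P \<noteq> {}" and u: "0 < u" and s: "0 < s" "s \<le> 1"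
    and salem: "(\<Sum>m\<in>fvecs F d - {fvec_zero F d}. cmod (fourier_coeff F d \<chi> P m) ^ u)
      \<le> C\<^sub>0 * q powr (- ((real u - 1) * real d)) * real (card P) powr (real u * (1 - s))"
    and small: "real (card P) \<le> C\<^sub>1 * q powr (real d / (real u * s))"
  shows "fourier_moment d P u
    \<le> (max 0 C\<^sub>0 + max 1 C\<^sub>1 ^ u) * (q powr real d * real (card P) powr (real u * (1 - s)))"
proof -
  define p D where "p = real (card P)" and "D = max 1 C\<^sub>1"
  have p: "p > 0"
    using P finite_fvecs finite_subset by (auto simp: p_def card_gt_0_iff)
  have D: "D \<ge> 1"
    by (simp add: D_def)
  have "p ^ u = p powr (real u * s) * p powr (real u * (1 - s))"
    using p by (simp add: powr_realpow[symmetric] right_diff_distrib flip: powr_add)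
  also have "p powr (real u * s) \<le> (D * q powr (real d / (real u * s))) powr (real u * s)"
  proof (intro powr_mono2)
    show "p \<le> D * q powr (real d / (real u * s))"
      using small unfolding p_def D_def
      by (meson max.cobounded2 mult_right_mono order_trans powr_ge_zero)
  qed (use p s in auto)
  also have "\<dots> = D powr (real u * s) * q powr real d"
    using D s u by (simp add: powr_mult powr_powr)
  \<comment> \<open>Since \<open>D \<ge> 1\<close> and \<open>s \<le> 1\<close>, the constant
    becomes independent of \<open>s\<close>.\<close>
  also have "D powr (real u * s) \<le> D powr real u"
    using D s by (intro powr_mono) (auto intro: mult_left_le)
  also have "D powr real u = D ^ u"
    using D by (simp add: powr_realpow)
  finally have trivial: "p ^ u \<le> D ^ u * q powr real d * p powr (real u * (1 - s))"
    by (simp add: mult_right_mono)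
  have "q ^ (d * u) * (\<Sum>m\<in>fvecs F d - {fvec_zero F d}. cmod (fourier_coeff F d \<chi> P m) ^ u)
      \<le> q ^ (d * u) * (max 0 C\<^sub>0 * q powr (- ((real u - 1) * real d)) * p powr (real u * (1 - s)))"
  proof (rule mult_left_mono)
    show "(\<Sum>m\<in>fvecs F d - {fvec_zero F d}. cmod (fourier_coeff F d \<chi> P m) ^ u)
        \<le> max 0 C\<^sub>0 * q powr (- ((real u - 1) * real d)) * p powr (real u * (1 - s))"
      using salem unfolding p_def
      by (meson max.cobounded2 mult_right_mono order_trans powr_ge_zero)
  qed simp
  also have "\<dots> = max 0 C\<^sub>0 * (q powr real (d * u) * q powr (- ((real u - 1) * real d)))
      * p powr (real u * (1 - s))"
    using q_pos by (simp only: powr_realpow mult_ac)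
  also have "q powr real (d * u) * q powr (- ((real u - 1) * real d)) = q powr real d"
    unfolding powr_add[symmetric] by (simp add: algebra_simps)
  finally show ?thesis
    using trivial by (simp add: fourier_moment_eq[OF P(1)] p_def D_def algebra_simps)
qed

end

theorem theorem4p5:
  fixes u :: nat and C\<^sub>0 C\<^sub>1 :: real
  assumes "even u" and "u \<ge> 4"
  shows "\<exists>C>0. \<forall>(F :: 'a ring) (d :: nat) (s :: real) (\<chi> :: 'a \<Rightarrow> complex)
            (P :: (nat \<Rightarrow> 'a) set) (S :: (nat \<Rightarrow> 'a) set set) (q :: nat).
      field F \<longrightarrow> finite (carrier F) \<longrightarrow> q = card (carrier F) \<longrightarrow>
      d \<ge> 2 \<longrightarrow> 0 < s \<longrightarrow> s \<le> 1 \<longrightarrow>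
      nontrivial_additive_character F \<chi> \<longrightarrow>
      P \<subseteq> fvecs F d \<longrightarrow>
      (\<Sum>m\<in>fvecs F d - {fvec_zero F d}. cmod (fourier_coeff F d \<chi> P m) ^ u)
        \<le> C\<^sub>0 * real q powr (- ((real u - 1) * real d)) * real (card P) powr (real u * (1 - s)) \<longrightarrow>
      S \<subseteq> fspheres F d \<longrightarrow> finite S \<longrightarrow>
      real (card P) \<le> C\<^sub>1 * real q powr (real d / (real u * s)) \<longrightarrow>
      \<bar>real (incidences P S) - real (card P) * real (card S) / real q\<bar>
        \<le> C * real q powr (real d / real u) * real (card P) powr (1 - s)
            * real (card S) powr (1 - 1 / real u)"
proof -
  obtain k where u: "u = 2 * k" and k: "0 < k"
    using assms by auto
  \<comment> \<open>The maxima make \<open>K\<close> positive for arbitrary real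
    \<open>C\<^sub>0\<close> and \<open>C\<^sub>1\<close>, and \<open>K\<close> depends on these and
    \<open>u\<close> alone.\<close>
  define K where "K = max 0 C\<^sub>0 + max 1 C\<^sub>1 ^ u"
  have "max 1 C\<^sub>1 ^ u > 0"
    by (intro zero_less_power) simp
  then have K: "K > 0"
    by (simp add: K_def add_nonneg_pos)
  show ?thesis
  \<comment> \<open>The root appears because the argument bounds the u-th power of the
    error.\<close>
  proof (intro exI[of _ "K powr (1 / real u)"] conjI allI impI)
    show "K powr (1 / real u) > 0"
      using K by simp
  next
    fix F :: "'a ring" and d :: nat and s :: real and \<chi> :: "'a \<Rightarrow> complex"
      and P :: "(nat \<Rightarrow> 'a) set" and S :: "(nat \<Rightarrow> 'a) set set" and q :: nat
    assume F: "field F" "finite (carrier F)" and q: "q = card (carrier F)"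
      and s: "0 < s" "s \<le> 1" and \<chi>: "nontrivial_additive_character F \<chi>"
      and P: "P \<subseteq> fvecs F d"
      and salem: "(\<Sum>m\<in>fvecs F d - {fvec_zero F d}. cmod (fourier_coeff F d \<chi> P m) ^ u)
        \<le> C\<^sub>0 * real q powr (- ((real u - 1) * real d)) * real (card P) powr (real u * (1 - s))"
      and S: "S \<subseteq> fspheres F d" "finite S"
      and small: "real (card P) \<le> C\<^sub>1 * real q powr (real d / (real u * s))"
    interpret finite_field_character F \<chi>
      by (intro finite_field_character.intro finite_field_character_axioms.intro F \<chi>)
    let ?E = "\<bar>real (incidences P S) - real (card P) * real (card S) / real q\<bar>"
    let ?R = "K powr (1 / real u) * real q powr (real d / real u) * real (card P) powr (1 - s)
            * real (card S) powr (1 - 1 / real u)"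
    show "?E \<le> ?R"
    \<comment> \<open>If either set is empty, both sides vanish; otherwise all bases are positive
      and \<open>powr\<close> agrees with integer powers.\<close>
    proof (cases "P = {} \<or> S = {}")
      case True
      then show ?thesis by (auto simp: incidences_def)
    next
      case False
      have pos: "real (card P) > 0" "real (card S) > 0" "real q > 0" "real u > 0"
        using False P S(2) finite_fvecs finite_subset q_pos k
        by (auto simp: card_gt_0_iff q u)
      have "?E ^ u \<le> real (card S) ^ (u - 1) * fourier_moment d P u"
        unfolding u q by (rule incidence_deviation_power_le[OF P S k])
      also have "\<dots> \<le> real (card S) ^ (u - 1)
          * (K * (real q powr real d * real (card P) powr (real u * (1 - s))))"
        using fourier_moment_le[OF P _ _ s salem[unfolded q] small[unfolded q]] False pos
        by (intro mult_left_mono) (auto simp: K_def q)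
      also have "\<dots> = ?R powr real u"
      proof -
        have "(1 - 1 / real u) * real u = real (u - 1)" "1 / real u * real u = 1"
            "real d / real u * real u = real d" "(1 - s) * real u = real u * (1 - s)"
          using pos by (auto simp: field_simps of_nat_diff)
        then have "?R powr real u = K * real q powr real d
            * real (card P) powr (real u * (1 - s)) * real (card S) powr real (u - 1)"
          using pos K by (simp only: powr_mult powr_powr powr_ge_zero mult_nonneg_nonneg) simp
        then show ?thesis
          using pos(2) by (simp only: powr_realpow mult_ac)
      qed
      also have "\<dots> = ?R ^ u"
        using pos K by (intro powr_realpow) simp
      finally show ?thesis
        using pos by (subst (asm) power_mono_iff) auto
    qed
  qed
qed

end
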